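(* Let $G$ be a uniformly bounded group. Then $G$ has only finitely many maximal normal subgroups.
   Context: A subset $S$ of a group $G$ normally generates $G$ if the normal subgroup of $G$ generated by $S$ is $G$; $G$ is finitely normally generated if some finite $S$ normally generates it. For such $S$, $\|g\|_S$ is the least $n\ge 0$ such that $g$ is a product of $n$ conjugates in $G$ of elements of $S$ and their inverses, and $\|G\|_S=\sup_{g\in G}\|g\|_S$. $\Delta(G)=\sup\{\|G\|_S : S \text{ finite, normally generates } G\}$. $G$ is uniformly bounded if it is finitely normally generated and $\Delta(G)<\infty$. A maximal normal subgroup is a proper normal subgroup maximal among proper normal subgroups. *)

theory Defs
  imports "HOL-Algebra.Algebra" "HOL-Library.Extended_Nat"
begin

definition normal_closure :: "('a, 'b) monoid_scheme \<Rightarrow> 'a set \<Rightarrow> 'a set" where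
  "normal_closure G S = \<Inter>{N. N \<lhd> G \<and> S \<subseteq> N}"

definition normally_generates :: "('a, 'b) monoid_scheme \<Rightarrow> 'a set \<Rightarrow> bool" where
  "normally_generates G S \<longleftrightarrow> S \<subseteq> carrier G \<and> normal_closure G S = carrier G"

definition finitely_normally_generated :: "('a, 'b) monoid_scheme \<Rightarrow> bool" where
  "finitely_normally_generated G \<longleftrightarrow> (\<exists>S. finite S \<and> normally_generates G S)"

definition signed_conjugates :: "('a, 'b) monoid_scheme \<Rightarrow> 'a set \<Rightarrow> 'a set" where
  "signed_conjugates G S =
     {x \<otimes>\<^bsub>G\<^esub> s \<otimes>\<^bsub>G\<^esub> inv\<^bsub>G\<^esub> x | x s. x \<in> carrier G \<and> s \<in> S \<union> set_inv\<^bsub>G\<^esub> S}"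

definition is_conj_product :: "('a, 'b) monoid_scheme \<Rightarrow> 'a set \<Rightarrow> nat \<Rightarrow> 'a \<Rightarrow> bool" where
  "is_conj_product G S n g \<longleftrightarrow>
     (\<exists>ws. length ws = n \<and> set ws \<subseteq> signed_conjugates G S \<and>
           g = foldr (\<otimes>\<^bsub>G\<^esub>) ws \<one>\<^bsub>G\<^esub>)"

(* The infimum in enat is the least such n whenever one exists (in particular for every
   g in G when S normally generates G), and infinity otherwise. *)
definition conj_norm :: "('a, 'b) monoid_scheme \<Rightarrow> 'a set \<Rightarrow> 'a \<Rightarrow> enat" where
  "conj_norm G S g = Inf {enat n | n. is_conj_product G S n g}"

definition conj_diameter :: "('a, 'b) monoid_scheme \<Rightarrow> 'a set \<Rightarrow> enat" where
  "conj_diameter G S = (SUP g\<in>carrier G. conj_norm G S g)"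

definition Delta :: "('a, 'b) monoid_scheme \<Rightarrow> enat" where
  "Delta G = Sup {conj_diameter G S | S. finite S \<and> normally_generates G S}"

definition uniformly_bounded :: "('a, 'b) monoid_scheme \<Rightarrow> bool" where
  "uniformly_bounded G \<longleftrightarrow> finitely_normally_generated G \<and> Delta G < \<infinity>"

definition maximal_normal_subgroup :: "'a set \<Rightarrow> ('a, 'b) monoid_scheme \<Rightarrow> bool" where
  "maximal_normal_subgroup M G \<longleftrightarrow>
     M \<lhd> G \<and> M \<noteq> carrier G \<and>
     (\<forall>N. N \<lhd> G \<and> N \<noteq> carrier G \<and> M \<subseteq> N \<longrightarrow> N = M)"

end

theory Submission
  imports Defs
begin

text \<open>
  Call a maximal normal subgroup abelian or not according to whether it contains the derived
  subgroup. A finite normally generating set \<open>S\<close> has finite diameter, and modulo the derived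
  subgroup a conjugate of \<open>s\<close> is just \<open>s\<close>; hence the abelianization is finite, and there are
  finitely many maximal normal subgroups of abelian type. A maximal normal subgroup of
  nonabelian type is prime: it contains an intersection of two normal subgroups only if it
  contains one of them. So for \<open>n\<close> distinct ones there are elements \<open>x\<^sub>i\<close> lying outside the
  \<open>i\<close>-th and inside all the others. The \<open>x\<^sub>i\<close>, together with finitely many elements of the
  intersection of the family, normally generate \<open>G\<close>. Each conjugate of such a generator lies
  outside at most one member of the family, so an element outside all of them, such as the
  product of the \<open>x\<^sub>i\<close>, has norm at least \<open>n\<close>, which bounds \<open>n\<close> by \<open>Delta G\<close>.
\<close>

section \<open>Normal subgroups, their products and normal closures\<close>

lemma (in group) inv_mult_cancel_left:
  assumes "x \<in> carrier G" "y \<in> carrier G"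
  shows "inv x \<otimes> (x \<otimes> y) = y" "x \<otimes> (inv x \<otimes> y) = y"
  using assms by (simp_all flip: m_assoc)

lemma (in group) normal_Inter:
  assumes "\<N> \<noteq> {}" and "\<And>N. N \<in> \<N> \<Longrightarrow> N \<lhd> G"
  shows "\<Inter>\<N> \<lhd> G"
  using assms subgroups_Inter[of \<N>] by (auto simp: normal_inv_iff)

lemma (in group) normal_set_mult:
  assumes "A \<lhd> G" "B \<lhd> G"
  shows "A <#> B \<lhd> G"
proof -
  interpret A: normal A G by fact
  interpret B: normal B G by fact
  have "x \<otimes> (a \<otimes> b) \<otimes> inv x \<in> A <#> B" if "x \<in> carrier G" "a \<in> A" "b \<in> B" for x a b
  proof -
    have [simp]: "a \<in> carrier G" "b \<in> carrier G" using that by auto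
    have "x \<otimes> (a \<otimes> b) \<otimes> inv x = (x \<otimes> a \<otimes> inv x) \<otimes> (x \<otimes> b \<otimes> inv x)"
      using that(1) by (simp add: m_assoc inv_mult_cancel_left)
    then show ?thesis
      using A.inv_op_closed2[OF that(1,2)] B.inv_op_closed2[OF that(1,3)]
      by (auto simp: set_mult_def)
  qed
  then show ?thesis
    unfolding normal_inv_iff
    using mult_norm_subgroup[OF assms(1) B.subgroup_axioms] by (auto simp: set_mult_def)
qed

lemma (in normal) foldr_mult_closed: "set ws \<subseteq> H \<Longrightarrow> foldr (\<otimes>) ws \<one> \<in> H"
  by (induction ws) auto

lemma (in group) normal_closure_normal:
  assumes "S \<subseteq> carrier G"
  shows "normal_closure G S \<lhd> G"
  unfolding normal_closure_def using assms normal_self by (intro normal_Inter) auto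

lemma subset_normal_closure: "S \<subseteq> normal_closure G S"
  unfolding normal_closure_def by auto

lemma normal_closure_subset: "N \<lhd> G \<Longrightarrow> S \<subseteq> N \<Longrightarrow> normal_closure G S \<subseteq> N"
  unfolding normal_closure_def by auto

lemma (in normal) signed_conjugate_in:
  assumes "x \<in> carrier G" "s \<in> H \<or> (\<exists>t\<in>H. s = inv t)"
  shows "x \<otimes> s \<otimes> inv x \<in> H"
  using assms by (intro inv_op_closed2) auto

section \<open>Signed conjugates and the conjugation norm\<close>

lemma signed_conjugatesE:
  assumes "w \<in> signed_conjugates G S"
  obtains x s t where "x \<in> carrier G" "s \<in> S" "t = s \<or> t = inv\<^bsub>G\<^esub> s"
    "w = x \<otimes>\<^bsub>G\<^esub> t \<otimes>\<^bsub>G\<^esub> inv\<^bsub>G\<^esub> x"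
  using assms unfolding signed_conjugates_def SET_INV_def by auto

lemma (in group) signed_conjugates_carrier:
  "S \<subseteq> carrier G \<Longrightarrow> signed_conjugates G S \<subseteq> carrier G"
  by (auto elim!: signed_conjugatesE)

lemma conj_norm_le_Delta:
  assumes "finite S" "normally_generates G S" "g \<in> carrier G"
  shows "conj_norm G S g \<le> Delta G"
proof -
  have "conj_norm G S g \<le> conj_diameter G S"
    unfolding conj_diameter_def using assms(3) by (intro SUP_upper)
  also have "\<dots> \<le> Delta G"
    unfolding Delta_def using assms by (intro Sup_upper) auto
  finally show ?thesis .
qed

text \<open>A finite bound rules out the empty set, whose infimum is \<infinity>; a nonempty set in
  \<open>enat\<close> attains its infimum, so the norm is realised by an actual product.\<close>

lemma conj_norm_leD:
  assumes "conj_norm G S g \<le> enat D"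
  obtains n where "n \<le> D" "is_conj_product G S n g"
proof -
  let ?A = "{enat n | n. is_conj_product G S n g}"
  have "?A \<noteq> {}"
    using assms unfolding conj_norm_def by (auto simp: Inf_enat_def split: if_splits)
  then have "Inf ?A \<in> ?A"
    by (auto simp: Inf_enat_def intro: LeastI)
  then show ?thesis
    using assms that unfolding conj_norm_def by auto
qed

section \<open>Maximal normal subgroups and primeness\<close>

lemma maximal_normal_imp_normal: "maximal_normal_subgroup M G \<Longrightarrow> M \<lhd> G"
  by (simp add: maximal_normal_subgroup_def)

text \<open>\<open>A <#> M\<close> is normal and strictly larger than \<open>M\<close>, hence all of
  \<open>G\<close> by maximality.\<close>

lemma (in group) maximal_normal_mult:
  assumes "maximal_normal_subgroup M G" "A \<lhd> G" "\<not> A \<subseteq> M" "g \<in> carrier G"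
  obtains a m where "a \<in> A" "m \<in> M" "g = a \<otimes> m"
proof -
  have M: "M \<lhd> G" using assms(1) by (rule maximal_normal_imp_normal)
  interpret A: normal A G by fact
  interpret M: normal M G by fact
  have "M \<subseteq> A <#> M"
  proof
    fix m assume "m \<in> M"
    then have "m = \<one> \<otimes> m" by auto
    with \<open>m \<in> M\<close> A.one_closed show "m \<in> A <#> M" unfolding set_mult_def by blast
  qed
  moreover have "A \<subseteq> A <#> M"
  proof
    fix a assume "a \<in> A"
    then have "a = a \<otimes> \<one>" by auto
    with \<open>a \<in> A\<close> M.one_closed show "a \<in> A <#> M" unfolding set_mult_def by blast
  qed
  moreover have "A <#> M \<lhd> G" by (intro normal_set_mult assms M)
  ultimately have "A <#> M = carrier G"
    using assms(1,3) unfolding maximal_normal_subgroup_def by blast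
  then have "g \<in> A <#> M" using assms(4) by simp
  with that show ?thesis unfolding set_mult_def by blast
qed

text \<open>\<open>A\<close> and \<open>B\<close> both map onto the quotient by \<open>M\<close>,
  and commutators of \<open>A\<close> with \<open>B\<close> lie in \<open>A \<inter> B\<close>. If
  that were inside \<open>M\<close>, the quotient would be abelian.\<close>

lemma (in group) maximal_normal_prime:
  assumes M: "maximal_normal_subgroup M G" and nab: "\<not> derived G (carrier G) \<subseteq> M"
    and A: "A \<lhd> G" "\<not> A \<subseteq> M" and B: "B \<lhd> G" "\<not> B \<subseteq> M"
  shows "\<not> A \<inter> B \<subseteq> M"
proof
  assume AB: "A \<inter> B \<subseteq> M"
  have "M \<lhd> G" using M by (rule maximal_normal_imp_normal)
  then interpret M: normal M G .
  interpret A: normal A G by fact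
  interpret B: normal B G by fact
  \<comment> \<open>Normality lets a coset absorb a factor from \<open>M\<close> on the right, so
    modulo \<open>M\<close> the elements \<open>g\<close>, \<open>h\<close> below may be replaced by
    \<open>a\<close>, \<open>b\<close>.\<close>
  have coset: "M #> (a \<otimes> m) = M #> a" if "a \<in> carrier G" "m \<in> M" for a m
  proof -
    have "a \<otimes> m \<in> a <# M" using that(2) unfolding l_coset_def by blast
    then have "a \<otimes> m \<in> M #> a" using M.coset_eq that(1) by simp
    then show ?thesis using repr_independence[OF _ that(1) M.subgroup_axioms] by simp
  qed
  have "g \<otimes> h \<otimes> inv g \<otimes> inv h \<in> M" if gh: "g \<in> carrier G" "h \<in> carrier G" for g h
  proof -
    obtain a m where a: "a \<in> A" "m \<in> M" "g = a \<otimes> m"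
      using maximal_normal_mult[OF M A gh(1)] .
    obtain b k where b: "b \<in> B" "k \<in> M" "h = b \<otimes> k"
      using maximal_normal_mult[OF M B gh(2)] .
    have [simp]: "a \<in> carrier G" "b \<in> carrier G" using a b by auto
    \<comment> \<open>The commutator is \<open>a\<close> times a conjugate of \<open>inv a\<close>,
      and also a conjugate of \<open>b\<close> times \<open>inv b\<close>; the two readings put it
      in \<open>A\<close> and in \<open>B\<close>.\<close>
    have "a \<otimes> b \<otimes> inv a \<otimes> inv b = a \<otimes> (b \<otimes> inv a \<otimes> inv b)"
      by (simp add: m_assoc)
    then have "a \<otimes> b \<otimes> inv a \<otimes> inv b \<in> A"
      using a(1) A.inv_op_closed2[of b "inv a"] by simp
    moreover have "a \<otimes> b \<otimes> inv a \<otimes> inv b \<in> B"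
      using b(1) B.inv_op_closed2[of a b] by simp
    ultimately have c: "a \<otimes> b \<otimes> inv a \<otimes> inv b \<in> M" using AB by auto
    have "a \<otimes> b = (a \<otimes> b \<otimes> inv a \<otimes> inv b) \<otimes> (b \<otimes> a)"
      by (simp add: m_assoc inv_mult_cancel_left)
    then have "a \<otimes> b \<in> M #> (b \<otimes> a)" using c unfolding r_coset_def by blast
    then have "M #> (a \<otimes> b) = M #> (b \<otimes> a)"
      using repr_independence[of "a \<otimes> b" M "b \<otimes> a"] M.subgroup_axioms by auto
    then have "(M #> a) <#> (M #> b) = (M #> b) <#> (M #> a)"
      by (simp add: M.rcos_sum)
    moreover have "M #> g = M #> a" "M #> h = M #> b"
      using a b coset by auto
    ultimately have "M #> (g \<otimes> h) = M #> (h \<otimes> g)"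
      using gh M.rcos_sum[of g h] M.rcos_sum[of h g] by simp
    then have "g \<otimes> h \<in> M #> (h \<otimes> g)"
      using gh rcos_self[of "g \<otimes> h" M] M.subgroup_axioms by simp
    then have "g \<otimes> h \<otimes> inv (h \<otimes> g) \<in> M"
      using gh by (intro M.rcos_module_imp group_axioms) auto
    then show ?thesis using gh by (simp add: inv_mult_group m_assoc)
  qed
  then have "derived G (carrier G) \<subseteq> M"
    unfolding derived_def by (intro generate_subgroup_incl M.subgroup_axioms) auto
  with nab show False ..
qed

text \<open>Induction with primeness: a member \<open>N\<close> of \<open>F\<close> is not inside
  \<open>M\<close>, since maximality of \<open>N\<close> would give \<open>N = M\<close>. Inserting
  \<open>carrier G\<close> gives the empty family the intersection \<open>carrier G\<close> instead
  of \<open>UNIV\<close>.\<close>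

lemma (in group) maximal_normal_prime_Inter:
  assumes "finite F" and "\<And>N. N \<in> F \<Longrightarrow> maximal_normal_subgroup N G"
    and M: "maximal_normal_subgroup M G" "\<not> derived G (carrier G) \<subseteq> M" and "M \<notin> F"
  shows "\<not> \<Inter>(insert (carrier G) F) \<subseteq> M"
  using assms(1,2,5)
proof (induction F)
  case empty
  have "M \<subseteq> carrier G" "M \<noteq> carrier G"
    using M(1) unfolding maximal_normal_subgroup_def
    by (auto dest: normal_imp_subgroup subgroup.subset)
  then show ?case by auto
next
  case (insert N F)
  have "maximal_normal_subgroup N G" "N \<noteq> M" using insert.prems by auto
  then have N: "N \<lhd> G" "\<not> N \<subseteq> M"
    using M(1) unfolding maximal_normal_subgroup_def by metis+
  have F: "\<Inter>(insert (carrier G) F) \<lhd> G"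
    using insert.prems normal_self by (intro normal_Inter) (auto intro: maximal_normal_imp_normal)
  have "\<not> N \<inter> \<Inter>(insert (carrier G) F) \<subseteq> M"
  proof (rule maximal_normal_prime[OF M N F])
    show "\<not> \<Inter>(insert (carrier G) F) \<subseteq> M"
      using insert.prems by (intro insert.IH) auto
  qed
  moreover have "\<Inter>(insert (carrier G) (insert N F)) = N \<inter> \<Inter>(insert (carrier G) F)"
    by auto
  ultimately show ?case by metis
qed

section \<open>Decomposition and separation for a family of maximal normal subgroups\<close>

text \<open>A Chinese remainder argument: modulo \<open>L\<close>, every element has a
  representative in the intersection. \<open>\<M>\<close> stays fixed while \<open>F\<close> grows;
  each step corrects \<open>k\<close> by an element of \<open>L\<close> that lies in all members but
  the new one.\<close>

lemma (in group) mult_Inter_maximal: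
  assumes "finite F" "F \<subseteq> \<M>" and max: "\<And>M. M \<in> \<M> \<Longrightarrow> maximal_normal_subgroup M G"
    and L: "L \<lhd> G" and sep: "\<And>M. M \<in> \<M> \<Longrightarrow> \<not> L \<inter> \<Inter>(\<M> - {M}) \<subseteq> M"
    and "g \<in> carrier G"
  shows "\<exists>l\<in>L. \<exists>k\<in>\<Inter>(insert (carrier G) F). g = l \<otimes> k"
  using assms(1,2)
proof (induction F)
  case empty
  interpret L: normal L G by fact
  show ?case using \<open>g \<in> carrier G\<close> by (intro bexI[of _ \<one>] bexI[of _ g]) auto
next
  case (insert M F)
  interpret L: normal L G by fact
  let ?A = "L \<inter> \<Inter>(\<M> - {M})"
  obtain l k where lk: "l \<in> L" "k \<in> \<Inter>(insert (carrier G) F)" "g = l \<otimes> k"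
    using insert by auto
  have norm: "N \<lhd> G" if "N \<in> \<M>" for N
    using max[OF that] by (rule maximal_normal_imp_normal)
  \<comment> \<open>Having \<open>L\<close> in the family keeps it nonempty even when
    \<open>\<M> - {M}\<close> is empty.\<close>
  have "\<Inter>(insert L (\<M> - {M})) \<lhd> G"
    using norm L by (intro normal_Inter) auto
  then have A: "?A \<lhd> G" by simp
  obtain a m where am: "a \<in> ?A" "m \<in> M" "k = a \<otimes> m"
    using maximal_normal_mult[OF max[of M] A sep[of M], of k] insert.prems lk(2) by auto
  have ac: "a \<in> carrier G" "m \<in> carrier G"
    using am norm[of M] insert.prems by (auto dest: normal_imp_subgroup subgroup.mem_carrier)
  \<comment> \<open>The correction moves \<open>k\<close> into \<open>M\<close> without leaving the
    earlier members: \<open>a\<close> lies in each of them, as \<open>M\<close> is not in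
    \<open>F\<close>.\<close>
  have "m \<in> N" if "N \<in> F" for N
  proof -
    interpret N: normal N G using norm that insert.prems by auto
    have "a \<in> N" using am(1) that insert by auto
    then have "inv a \<otimes> k \<in> N" using lk(2) that by auto
    then show ?thesis using am(3) ac by (simp add: m_assoc[symmetric])
  qed
  then have "m \<in> \<Inter>(insert (carrier G) (insert M F))" using am ac by auto
  moreover have "l \<otimes> a \<in> L" using lk am by auto
  moreover have "g = (l \<otimes> a) \<otimes> m" using lk am ac by (simp add: m_assoc)
  ultimately show ?case by blast
qed

text \<open>Multiplying by \<open>x N\<close> changes membership in \<open>N\<close> alone. Taking
  \<open>F = \<M>\<close> yields an element outside every member.\<close>

lemma (in group) separated_product:
  assumes "finite F" "F \<subseteq> \<M>" and norm: "\<And>M. M \<in> \<M> \<Longrightarrow> M \<lhd> G"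
    and x: "\<And>M. M \<in> \<M> \<Longrightarrow> x M \<in> carrier G" "\<And>M. M \<in> \<M> \<Longrightarrow> x M \<notin> M"
      "\<And>M N. M \<in> \<M> \<Longrightarrow> N \<in> \<M> \<Longrightarrow> N \<noteq> M \<Longrightarrow> x M \<in> N"
  shows "\<exists>g\<in>carrier G. \<forall>M\<in>\<M>. g \<in> M \<longleftrightarrow> M \<notin> F"
  using assms(1,2)
proof (induction F)
  case empty
  then show ?case
    using norm by (intro bexI[of _ \<one>]) (auto dest: normal_imp_subgroup subgroup.one_closed)
next
  case (insert N F)
  then obtain g where g: "g \<in> carrier G" "\<And>M. M \<in> \<M> \<Longrightarrow> g \<in> M \<longleftrightarrow> M \<notin> F" by auto
  have N: "N \<in> \<M>" using insert.prems by simp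
  have "g \<otimes> x N \<in> M \<longleftrightarrow> M \<notin> insert N F" if M: "M \<in> \<M>" for M
  proof -
    interpret M: normal M G using norm M .
    show ?thesis
    proof (cases "M = N")
      case True
      then have "g \<in> M" using g(2) M insert.hyps by auto
      moreover have "x N = inv g \<otimes> (g \<otimes> x N)"
        using g x(1)[OF N] by (simp add: m_assoc[symmetric])
      ultimately have "g \<otimes> x N \<notin> M"
        using x(2)[OF N] True M.m_closed M.m_inv_closed by metis
      with True show ?thesis by simp
    next
      case False
      then have xN: "x N \<in> M" using x(3)[OF N M] by simp
      have "g = (g \<otimes> x N) \<otimes> inv (x N)" using g x(1)[OF N] by (simp add: m_assoc)
      then have "g \<otimes> x N \<in> M \<longleftrightarrow> g \<in> M"
        using xN M.m_closed M.m_inv_closed by metis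
      with False g(2)[OF M] show ?thesis by simp
    qed
  qed
  then show ?case using g(1) x(1)[OF N] by (intro bexI[of _ "g \<otimes> x N"]) auto
qed

section \<open>The lower bound on the norm in the nonabelian case\<close>

text \<open>A product can miss \<open>M\<close> only if some factor misses \<open>M\<close>, so the
  number of missed members is subadditive.\<close>

lemma card_missed_le_length:
  assumes "finite F" and norm: "\<And>M. M \<in> F \<Longrightarrow> M \<lhd> G"
    and one: "\<And>w. w \<in> set ws \<Longrightarrow> card {M\<in>F. w \<notin> M} \<le> 1"
  shows "card {M\<in>F. foldr (\<otimes>\<^bsub>G\<^esub>) ws \<one>\<^bsub>G\<^esub> \<notin> M} \<le> length ws"
  using one
proof (induction ws)
  case Nil
  have "\<one>\<^bsub>G\<^esub> \<in> M" if "M \<in> F" for M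
    using norm[OF that] by (auto dest: normal_imp_subgroup subgroup.one_closed)
  then have *: "{M\<in>F. \<one>\<^bsub>G\<^esub> \<notin> M} = {}" by blast
  show ?case by (simp add: *)
next
  case (Cons w ws)
  let ?r = "foldr (\<otimes>\<^bsub>G\<^esub>) ws \<one>\<^bsub>G\<^esub>"
  have "{M\<in>F. w \<otimes>\<^bsub>G\<^esub> ?r \<notin> M} \<subseteq> {M\<in>F. w \<notin> M} \<union> {M\<in>F. ?r \<notin> M}"
    using norm by (auto dest: normal_imp_subgroup subgroup.m_closed)
  then have "card {M\<in>F. w \<otimes>\<^bsub>G\<^esub> ?r \<notin> M} \<le> card ({M\<in>F. w \<notin> M} \<union> {M\<in>F. ?r \<notin> M})"
    using \<open>finite F\<close> by (intro card_mono) auto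
  also have "\<dots> \<le> card {M\<in>F. w \<notin> M} + card {M\<in>F. ?r \<notin> M}" by (rule card_Un_le)
  also have "\<dots> \<le> 1 + length ws" using Cons by (intro add_mono) auto
  finally show ?case by simp
qed

lemma (in group) nonabelian_maximal_norm_ge:
  assumes "finite F" and max: "\<And>M. M \<in> F \<Longrightarrow> maximal_normal_subgroup M G"
    and nab: "\<And>M. M \<in> F \<Longrightarrow> \<not> derived G (carrier G) \<subseteq> M"
    and T: "finite T" "normally_generates G T"
  obtains S g where "finite S" "normally_generates G S" "g \<in> carrier G"
    "\<forall>n. is_conj_product G S n g \<longrightarrow> card F \<le> n"
proof -
  have norm: "M \<lhd> G" if "M \<in> F" for M
    using max[OF that] by (rule maximal_normal_imp_normal)
  \<comment> \<open>By primeness the intersection of the remaining members is not inside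
    \<open>M\<close>.\<close>
  have "\<exists>x. x \<in> carrier G \<and> x \<notin> M \<and> (\<forall>N\<in>F. N \<noteq> M \<longrightarrow> x \<in> N)" if "M \<in> F" for M
    using maximal_normal_prime_Inter[of "F - {M}" M] assms(1) max nab that by auto
  then obtain x where x: "\<And>M. M \<in> F \<Longrightarrow> x M \<in> carrier G" "\<And>M. M \<in> F \<Longrightarrow> x M \<notin> M"
      "\<And>M N. M \<in> F \<Longrightarrow> N \<in> F \<Longrightarrow> N \<noteq> M \<Longrightarrow> x M \<in> N"
    by metis
  define L where "L = normal_closure G (x ` F)"
  have L: "L \<lhd> G" unfolding L_def using x(1) by (intro normal_closure_normal) auto
  have xL: "x M \<in> L" if "M \<in> F" for M
    using subset_normal_closure[of "x ` F" G] that unfolding L_def by auto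
  have sep: "\<not> L \<inter> \<Inter>(F - {M}) \<subseteq> M" if "M \<in> F" for M
    using xL[OF that] x(2)[OF that] x(3)[OF that] by auto
  have TG: "T \<subseteq> carrier G" using T(2) by (simp add: normally_generates_def)
  \<comment> \<open>\<open>L\<close> may be far from \<open>G\<close>, so the given generators
    \<open>T\<close> are split into a part in \<open>L\<close> and a part \<open>k t\<close> in the
    whole intersection. Adding the \<open>k t\<close> to the \<open>x M\<close> recovers
    \<open>T\<close>, and the \<open>k t\<close> miss no member of \<open>F\<close>.\<close>
  have "\<exists>l\<in>L. \<exists>k\<in>\<Inter>(insert (carrier G) F). t = l \<otimes> k" if "t \<in> T" for t
    using that TG by (intro mult_Inter_maximal[OF assms(1) order_refl max L sep]) auto
  then obtain l k where lk: "\<And>t. t \<in> T \<Longrightarrow> l t \<in> L"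
      "\<And>t. t \<in> T \<Longrightarrow> k t \<in> \<Inter>(insert (carrier G) F)" "\<And>t. t \<in> T \<Longrightarrow> t = l t \<otimes> k t"
    by metis
  define S where "S = x ` F \<union> k ` T"
  have fin: "finite S" using assms(1) T(1) by (simp add: S_def)
  have SG: "S \<subseteq> carrier G" using x(1) lk(2) by (auto simp: S_def)
  have NS: "normal_closure G S \<lhd> G" using SG by (rule normal_closure_normal)
  then interpret NS: normal "normal_closure G S" G .
  have "L \<subseteq> normal_closure G S"
    unfolding L_def using subset_normal_closure[of S G]
    by (intro normal_closure_subset NS) (auto simp: S_def)
  then have "l t \<otimes> k t \<in> normal_closure G S" if "t \<in> T" for t
    using lk(1)[OF that] that subset_normal_closure[of S G]
    by (intro NS.m_closed) (auto simp: S_def)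
  then have "T \<subseteq> normal_closure G S"
    using lk(3) by (metis subsetI)
  then have "carrier G \<subseteq> normal_closure G S"
    using normal_closure_subset[OF NS, of T] T(2) by (simp add: normally_generates_def)
  then have gen: "normally_generates G S"
    using SG NS.subset by (auto simp: normally_generates_def)
  have one: "card {M\<in>F. w \<notin> M} \<le> 1" if w: "w \<in> signed_conjugates G S" for w
  proof -
    obtain y s t where w: "y \<in> carrier G" "s \<in> S" "t = s \<or> t = inv s" "w = y \<otimes> t \<otimes> inv y"
      using signed_conjugatesE[OF w] .
    \<comment> \<open>Inverting and conjugating cannot leave a normal subgroup, so \<open>w\<close>
      misses no more than its base letter \<open>s\<close>.\<close>
    have "{M\<in>F. w \<notin> M} \<subseteq> {M\<in>F. s \<notin> M}"
    proof clarify
      fix M assume "M \<in> F" "w \<notin> M" "s \<in> M"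
      then show False
        using normal.signed_conjugate_in[OF norm, of M y t] w by auto
    qed
    \<comment> \<open>\<open>x N\<close> misses at most \<open>N\<close>; for \<open>s = k t\<close>
      nothing is missed and any \<open>N\<close> serves.\<close>
    moreover obtain N where "{M\<in>F. s \<notin> M} \<subseteq> {N}"
    proof -
      from w(2) consider N where "N \<in> F" "s = x N" | t where "t \<in> T" "s = k t"
        unfolding S_def by auto
      then show ?thesis
        by cases (use x(3) lk(2) that in blast)+
    qed
    ultimately have "{M\<in>F. w \<notin> M} \<subseteq> {N}" by auto
    then show ?thesis using card_mono[of "{N}"] by fastforce
  qed
  \<comment> \<open>This \<open>g\<close> misses all of \<open>F\<close>, while each factor of a
    word for it misses at most one member.\<close>
  obtain g where g: "g \<in> carrier G" "\<forall>M\<in>F. g \<notin> M"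
    using separated_product[of F F x] assms(1) norm x by auto
  have "card F \<le> n" if "is_conj_product G S n g" for n
  proof -
    obtain ws where ws: "length ws = n" "set ws \<subseteq> signed_conjugates G S" "g = foldr (\<otimes>) ws \<one>"
      using \<open>is_conj_product G S n g\<close> unfolding is_conj_product_def by auto
    have "card {M\<in>F. g \<notin> M} \<le> n"
      using card_missed_le_length[of F G ws] assms(1) norm one ws by auto
    moreover have "{M\<in>F. g \<notin> M} = F" using g(2) by auto
    ultimately show ?thesis by simp
  qed
  with that fin gen g(1) show ?thesis by blast
qed

section \<open>Finiteness of the abelianization and the subgroups above the derived subgroup\<close>

text \<open>Modulo the derived subgroup the conjugating elements disappear, so each coset is named
  by a word of length at most \<open>D\<close> over the finite alphabet
  \<open>S \<union> set_inv S\<close>.\<close>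

lemma (in group) finite_abelianization:
  assumes "finite S" "S \<subseteq> carrier G"
    and bound: "\<And>g. g \<in> carrier G \<Longrightarrow> \<exists>n\<le>D. is_conj_product G S n g"
  shows "finite (rcosets (derived G (carrier G)))"
proof -
  let ?N = "derived G (carrier G)"
  interpret N: normal ?N G by (rule derived_self_is_normal)
  let ?B = "S \<union> set_inv S"
  let ?L = "{ss. set ss \<subseteq> ?B \<and> length ss \<le> D}"
  have B: "finite ?B" "?B \<subseteq> carrier G" using assms(1,2) by (auto simp: SET_INV_def)
  have conj: "?N #> (x \<otimes> s \<otimes> inv x) = ?N #> s" if "x \<in> carrier G" "s \<in> carrier G" for x s
  proof -
    \<comment> \<open>A conjugate differs from its base letter by a commutator.\<close>
    have "x \<otimes> s \<otimes> inv x \<otimes> inv s \<in> ?N"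
      unfolding derived_def using that by (intro generate.incl) auto
    moreover have "x \<otimes> s \<otimes> inv x = (x \<otimes> s \<otimes> inv x \<otimes> inv s) \<otimes> s"
      using that by (simp add: m_assoc)
    ultimately have "x \<otimes> s \<otimes> inv x \<in> ?N #> s" unfolding r_coset_def by blast
    then show ?thesis
      using repr_independence[of _ ?N s] that N.subgroup_axioms by auto
  qed
  have words: "\<exists>ss. set ss \<subseteq> ?B \<and> length ss = length ws \<and>
      ?N #> foldr (\<otimes>) ws \<one> = ?N #> foldr (\<otimes>) ss \<one>" if "set ws \<subseteq> signed_conjugates G S" for ws
    using that
  proof (induction ws)
    case (Cons w ws)
    then obtain ss where ss: "set ss \<subseteq> ?B" "length ss = length ws"
        "?N #> foldr (\<otimes>) ws \<one> = ?N #> foldr (\<otimes>) ss \<one>" by auto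
    from Cons.prems obtain x s where w: "x \<in> carrier G" "s \<in> ?B" "w = x \<otimes> s \<otimes> inv x"
      unfolding signed_conjugates_def by auto
    interpret C: normal "carrier G" G by (rule normal_self)
    have s: "s \<in> carrier G" using w B by auto
    have "foldr (\<otimes>) ss \<one> \<in> carrier G" "foldr (\<otimes>) ws \<one> \<in> carrier G"
      using ss B Cons.prems signed_conjugates_carrier[OF assms(2)]
      by (auto intro!: C.foldr_mult_closed)
    then have "?N #> foldr (\<otimes>) (w # ws) \<one> = ?N #> foldr (\<otimes>) (s # ss) \<one>"
      using w s ss(3) conj[OF w(1) s] by (simp flip: N.rcos_sum)
    then show ?case using ss w by (intro exI[of _ "s # ss"]) auto
  qed simp
  have "rcosets ?N \<subseteq> (\<lambda>ss. ?N #> foldr (\<otimes>) ss \<one>) ` ?L"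
  proof
    fix C assume "C \<in> rcosets ?N"
    then obtain g where g: "g \<in> carrier G" "C = ?N #> g" unfolding RCOSETS_def by auto
    obtain ws where ws: "length ws \<le> D" "set ws \<subseteq> signed_conjugates G S" "g = foldr (\<otimes>) ws \<one>"
      using bound[OF g(1)] unfolding is_conj_product_def by auto
    then show "C \<in> (\<lambda>ss. ?N #> foldr (\<otimes>) ss \<one>) ` ?L"
      using words[OF ws(2)] g(2) by (smt (verit) image_iff mem_Collect_eq)
  qed
  then show ?thesis
    using finite_lists_length_le[OF B(1)] finite_surj by blast
qed

text \<open>Such an \<open>H\<close> is the union of the cosets of its elements, hence determined by
  a subset of the finite set of cosets.\<close>

lemma (in group) finite_subgroups_above:
  assumes "subgroup N G" "finite (rcosets N)"
  shows "finite {H. subgroup H G \<and> N \<subseteq> H}"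
proof (rule finite_subset)
  show "{H. subgroup H G \<and> N \<subseteq> H} \<subseteq> Union ` Pow (rcosets N)"
  proof clarify
    fix H assume H: "subgroup H G" "N \<subseteq> H"
    have "H = \<Union>((\<lambda>h. N #> h) ` H)"
    proof
      show "H \<subseteq> \<Union>((\<lambda>h. N #> h) ` H)"
        using rcos_self[OF subgroup.mem_carrier[OF H(1)] assms(1)] by blast
      show "\<Union>((\<lambda>h. N #> h) ` H) \<subseteq> H"
        using H(2) subgroup.m_closed[OF H(1)] unfolding r_coset_def by blast
    qed
    moreover have "(\<lambda>h. N #> h) ` H \<in> Pow (rcosets N)"
      using subgroup.mem_carrier[OF H(1)] by (auto simp: RCOSETS_def)
    ultimately show "H \<in> Union ` Pow (rcosets N)" by blast
  qed
qed (use assms in simp)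

theorem theorem1p5:
  fixes G :: "('a, 'b) monoid_scheme"
  assumes "group G"
    and "uniformly_bounded G"
  shows "finite {M. maximal_normal_subgroup M G}"
proof -
  interpret group G by fact
  let ?N = "derived G (carrier G)"
  obtain T where T: "finite T" "normally_generates G T"
    using assms(2) unfolding uniformly_bounded_def finitely_normally_generated_def by auto
  obtain D where D: "Delta G = enat D"
    using assms(2) unfolding uniformly_bounded_def by (cases "Delta G") auto
  \<comment> \<open>One \<open>D\<close> serves all finite normally generating sets. This uniformity
    is essential below, where \<open>S\<close> varies with the family \<open>F\<close>.\<close>
  have bound: "\<exists>n\<le>D. is_conj_product G S n g"
    if "finite S" "normally_generates G S" "g \<in> carrier G" for S g
    using conj_norm_le_Delta[OF that] unfolding D by (auto elim: conj_norm_leD)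
  have "finite (rcosets\<^bsub>G\<^esub> ?N)"
    using finite_abelianization[of T D] bound T by (auto simp: normally_generates_def)
  then have "finite {H. subgroup H G \<and> ?N \<subseteq> H}"
    by (intro finite_subgroups_above derived_is_subgroup) auto
  then have abelian: "finite {M. maximal_normal_subgroup M G \<and> ?N \<subseteq> M}"
    by (rule rev_finite_subset) (auto intro: maximal_normal_imp_normal normal_imp_subgroup)
  let ?X = "{M. maximal_normal_subgroup M G \<and> \<not> ?N \<subseteq> M}"
  \<comment> \<open>\<open>?X\<close> is not yet known to be finite, so the bound is proved for its
    finite subsets; a common bound on their sizes forces \<open>?X\<close> to be finite.\<close>
  have "card F \<le> D" if "F \<subseteq> ?X" "finite F" for F
  proof -
    have F: "maximal_normal_subgroup M G" "\<not> ?N \<subseteq> M" if "M \<in> F" for M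
      using \<open>F \<subseteq> ?X\<close> that by auto
    obtain S g where Sg: "finite S" "normally_generates G S" "g \<in> carrier G"
        "\<forall>n. is_conj_product G S n g \<longrightarrow> card F \<le> n"
      by (rule nonabelian_maximal_norm_ge[OF \<open>finite F\<close> F T])
    obtain n where "n \<le> D" "is_conj_product G S n g" using bound[OF Sg(1-3)] by blast
    with Sg(4) show ?thesis by force
  qed
  then have "finite ?X" using finite_if_finite_subsets_card_bdd[of ?X D] by blast
  with abelian have "finite ({M. maximal_normal_subgroup M G \<and> ?N \<subseteq> M} \<union> ?X)" by blast
  then show ?thesis by (rule rev_finite_subset) auto
qed

end
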